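(* Let $n\ge 1$ and let $a_1,\dots,a_n$ be integers with $a_m\ge 2$ for all $m$. Then the sandpile group of $Ch_n(a_1,\dots,a_n)$ is cyclic of order $F_n(a_1,\dots,a_n)$, which also equals $G_n(a_1,\dots,a_n)$: $S(Ch_n(a_1,\dots,a_n))\cong C_{F_n(a_1,\dots,a_n)}\cong C_{G_n(a_1,\dots,a_n)}$.
   Context: $Ch_n(a_1,\dots,a_n)$ is the following multigraph ("chain" of $n$ cycles of lengths $a_1,\dots,a_n$, each consecutive pair sharing an edge, all cycles sharing a common vertex). Let $s_0=1$ and $s_j=1+\sum_{m=1}^{j}(a_m-2)$ for $1\le j\le n$, and $k=s_n$. The vertices are $u_1,\dots,u_k$ and a center $c$; the edges are the path edges $u_1u_2,u_2u_3,\dots,u_{k-1}u_k$ together with, for each $j=0,1,\dots,n$, one edge $c\,u_{s_j}$ (so if $s_j=s_{j'}$ for $j\ne j'$, there are multiple edges between $c$ and $u_{s_j}$). Then for each $j$ the vertices $c,u_{s_{j-1}},\dots,u_{s_j}$ form a cycle of length $a_j$. For a finite multigraph $X$ with Laplacian matrix $L$ (diagonal entries the vertex degrees, off-diagonal entry $(u,v)$ equal to minus the number of edges between $u$ and $v$), the sandpile group is $S(X)\cong\bigoplus_a C_{|a|}$ over the nonzero diagonal entries $a$ of the Smith normal form of $L$; $C_m$ is the cyclic group of order $m$. $F_n$ is defined recursively by $F_1(x_1)=x_1$ and $F_{i+1}(x_1,\dots,x_{i+1})=F_i(x_1,\dots,x_{i-1},x_i-1)+(x_{i+1}-1)F_i(x_1,\dots,x_i)$.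 For non-negative integers $i,j$, $C_{i,j}$ is the set of subsets $I\subseteq\{1,\dots,j\}$ with $|I|=i$ such that consecutive elements of $I$ differ by an odd number and $j-\max(I)$ is even (with $\max(\emptyset)=0$); $\gamma_{i,j}(x_1,\dots,x_j)=\sum_{I\in C_{i,j}}\prod_{m\in I}x_m$; and $G_n=\sum_{0\le m\le n/2}(-1)^m\gamma_{n-2m,n}$. *)

theory Defs
  imports
    "HOL-Library.Multiset"
    "HOL-Algebra.Elementary_Groups"
    "HOL-Algebra.Product_Groups"
    "Jordan_Normal_Form.Matrix"
begin

section \<open>Multigraphs and sandpile groups\<close>

text \<open>An edge is the set of its two end points; the multiplicity of an edge is its multiplicity
  in the multiset.\<close>

record 'v multigraph =
  verts :: "'v set"
  edges :: "'v set multiset"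

definition finite_multigraph :: "'v multigraph \<Rightarrow> bool" where
  "finite_multigraph X \<longleftrightarrow>
     finite (verts X) \<and> (\<forall>e \<in># edges X. e \<subseteq> verts X \<and> card e = 2)"

definition degree :: "'v multigraph \<Rightarrow> 'v \<Rightarrow> nat" where
  "degree X v = size {#e \<in># edges X. v \<in> e#}"

text \<open>Rows and columns follow the linear order of the vertices. Another enumeration only changes
  the matrix by a simultaneous permutation of rows and columns, which does not affect its
  Smith normal forms.\<close>

definition laplacian :: "('v::linorder) multigraph \<Rightarrow> int mat" where
  "laplacian X =
     (let vs = sorted_list_of_set (verts X)
      in mat (length vs) (length vs)
           (\<lambda>(i, j). if i = j then int (degree X (vs ! i))
                     else - int (count (edges X) {vs ! i, vs ! j})))"

text \<open>The diagonal entries are not normalised to be non-negative, so a Smith normal form is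
  unique only up to the signs of its entries.\<close>

definition smith_normal_form_of :: "int mat \<Rightarrow> int mat \<Rightarrow> bool" where
  "smith_normal_form_of A D \<longleftrightarrow>
     (\<exists>P Q. P \<in> carrier_mat (dim_row A) (dim_row A) \<and> invertible_mat P \<and>
            Q \<in> carrier_mat (dim_col A) (dim_col A) \<and> invertible_mat Q \<and>
            D = P * A * Q) \<and>
     diagonal_mat D \<and>
     (\<forall>i. Suc i < min (dim_row D) (dim_col D) \<longrightarrow> D $$ (i, i) dvd D $$ (Suc i, Suc i))"

definition sandpile_group :: "('v::linorder) multigraph \<Rightarrow> (nat \<Rightarrow> int) monoid" where
  "sandpile_group X =
     (let D = (SOME D. smith_normal_form_of (laplacian X) D)
      in sum_group {i. i < dim_row D \<and> D $$ (i, i) \<noteq> 0}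
           (\<lambda>i. integer_mod_group (nat \<bar>D $$ (i, i)\<bar>)))"


section \<open>Chains of cycles\<close>

definition chain_pos :: "(nat \<Rightarrow> int) \<Rightarrow> nat \<Rightarrow> int" where
  "chain_pos a j = 1 + (\<Sum>m = 1..j. a m - 2)"

text \<open>The center is the vertex \<open>0\<close>, and \<open>u\<^sub>i\<close> is the vertex \<open>i\<close> for \<open>1 \<le> i \<le> k = chain_pos a n\<close>.\<close>

definition chain :: "nat \<Rightarrow> (nat \<Rightarrow> int) \<Rightarrow> int multigraph" where
  "chain n a =
     \<lparr> verts = {0} \<union> {1..chain_pos a n},
       edges = image_mset (\<lambda>i. {i, i + 1}) (mset_set {1..<chain_pos a n})
             + image_mset (\<lambda>j. {0, chain_pos a j}) (mset_set {0..n}) \<rparr>"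

lemma chain_pos_mono:
  assumes "\<And>m. 1 \<le> m \<Longrightarrow> m \<le> n \<Longrightarrow> 2 \<le> a m" "i \<le> j" "j \<le> n"
  shows "chain_pos a i \<le> chain_pos a j"
  unfolding chain_pos_def
  using assms by (intro add_left_mono sum_mono2) auto

lemma finite_multigraph_chain:
  assumes "\<And>m. 1 \<le> m \<Longrightarrow> m \<le> n \<Longrightarrow> 2 \<le> a m"
  shows "finite_multigraph (chain n a)"
proof -
  have "1 \<le> chain_pos a j" "chain_pos a j \<le> chain_pos a n" if "j \<le> n" for j
    using chain_pos_mono[of n a 0 j] chain_pos_mono[of n a j n] assms that
    by (auto simp: chain_pos_def[of a 0])
  then show ?thesis
    by (fastforce simp: finite_multigraph_def chain_def card_insert_if)
qed


section \<open>The polynomials \<open>F\<^sub>n\<close> and \<open>G\<^sub>n\<close>\<close>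

text \<open>The value at \<open>n = 0\<close> is a dummy: \<open>F\<^sub>n\<close> is only meant for \<open>n \<ge> 1\<close>.\<close>

fun F :: "nat \<Rightarrow> (nat \<Rightarrow> int) \<Rightarrow> int" where
  "F 0 x = 1"
| "F (Suc 0) x = x 1"
| "F (Suc (Suc i)) x =
     F (Suc i) (x(Suc i := x (Suc i) - 1)) + (x (Suc (Suc i)) - 1) * F (Suc i) x"

definition consecutive_in :: "nat set \<Rightarrow> nat \<Rightarrow> nat \<Rightarrow> bool" where
  "consecutive_in I p q \<longleftrightarrow> p \<in> I \<and> q \<in> I \<and> p < q \<and> \<not> (\<exists>r\<in>I. p < r \<and> r < q)"

definition C :: "nat \<Rightarrow> nat \<Rightarrow> nat set set" where
  "C i j = {I. I \<subseteq> {1..j} \<and> card I = i \<and>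
               (\<forall>p q. consecutive_in I p q \<longrightarrow> odd (q - p)) \<and>
               even (j - (if I = {} then 0 else Max I))}"

definition \<gamma> :: "nat \<Rightarrow> nat \<Rightarrow> (nat \<Rightarrow> int) \<Rightarrow> int" where
  "\<gamma> i j x = (\<Sum>I\<in>C i j. \<Prod>m\<in>I. x m)"

definition G :: "nat \<Rightarrow> (nat \<Rightarrow> int) \<Rightarrow> int" where
  "G n x = (\<Sum>m | 2 * m \<le> n. (-1) ^ m * \<gamma> (n - 2 * m) n x)"

end

theory Submission
  imports Defs "Jordan_Normal_Form.Determinant"
begin

text \<open>Both \<open>F\<close> and \<open>G\<close> satisfy the continuant recurrence
  \<open>K\<^sub>n = x\<^sub>n K\<^bsub>n-1\<^esub> - K\<^bsub>n-2\<^esub>\<close>, for \<open>G\<close> by splitting the index sets according to whether they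
  contain \<open>n\<close>.

  Since consecutive path vertices are joined by a single edge, a function on the vertices that is
  harmonic at \<open>u\<^sub>1, \<dots>, u\<^bsub>k-1\<^esub>\<close> is determined by its values at the center and at \<open>u\<^sub>1\<close>. For the
  values \<open>0\<close> and \<open>1\<close> this potential has slope \<open>F\<^sub>j\<close> behind the spoke \<open>j\<close>, so the Laplacian maps it
  to \<open>F\<^sub>n (u\<^sub>k - c)\<close>; it kills the constants, and it maps \<open>u\<^sub>2, \<dots>, u\<^sub>k\<close> to vectors that form a
  basis together with \<open>u\<^sub>k - c\<close> and \<open>c\<close>. This gives the Smith normal form \<open>diag(1, \<dots>, 1, F\<^sub>n, 0)\<close>.

  Any other Smith normal form has the same diagonal up to signs, because the number of solutions
  of \<open>A x = 0\<close> modulo \<open>m\<close> is invariant under equivalence and equals \<open>\<Prod>i. gcd d\<^sub>i m\<close> for a diagonal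
  matrix, and these numbers determine a divisor chain up to signs.\<close>

section \<open>The polynomials\<close>

lemma F_fun_upd_greater: "n < p \<Longrightarrow> F n (x(p := v)) = F n x"
proof (induction n x rule: F.induct)
  case (3 i x)
  have "x(p := v, Suc i := w) = x(Suc i := w, p := v)" for w
    using "3.prems" by (intro fun_upd_twist) simp
  moreover have "(x(p := v)) (Suc i) = x (Suc i)" "(x(p := v)) (Suc (Suc i)) = x (Suc (Suc i))"
    using "3.prems" by auto
  ultimately show ?case using 3 by (simp del: fun_upd_apply)
qed auto

lemma F_decrease_last: "F (Suc n) (x(Suc n := x (Suc n) - 1)) = F (Suc n) x - F n x"
proof (cases n)
  case (Suc i)
  have "x(Suc (Suc i) := v, Suc i := w) = x(Suc i := w, Suc (Suc i) := v)" for v w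
    by (intro fun_upd_twist) simp
  with Suc show ?thesis by (simp add: F_fun_upd_greater algebra_simps)
qed simp

lemma F_rec: "F (Suc (Suc n)) x = x (Suc (Suc n)) * F (Suc n) x - F n x"
  by (simp add: F_decrease_last algebra_simps)

lemma F_pos_and_mono:
  assumes "\<And>m. 1 \<le> m \<Longrightarrow> m \<le> Suc n \<Longrightarrow> 2 \<le> x m"
  shows "0 < F n x \<and> F n x \<le> F (Suc n) x"
  using assms
proof (induction n)
  case 0
  then show ?case using "0"[of 1] by simp
next
  case (Suc n)
  then have IH: "0 < F n x" "F n x \<le> F (Suc n) x"
    by auto
  have "2 * F (Suc n) x \<le> x (Suc (Suc n)) * F (Suc n) x"
    using IH Suc.prems by (intro mult_right_mono) auto
  with IH show ?case by (simp only: F_rec) linarith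
qed

lemma F_pos:
  assumes "\<And>m. 1 \<le> m \<Longrightarrow> m \<le> n \<Longrightarrow> 2 \<le> x m"
  shows "0 < F n x"
proof (cases n)
  case (Suc n')
  with F_pos_and_mono[of n' x] assms show ?thesis by fastforce
qed simp

lemma consecutive_in_insert_top:
  assumes "finite I" and below: "\<And>i. i \<in> I \<Longrightarrow> i < t"
  shows "consecutive_in (insert t I) p q \<longleftrightarrow>
    consecutive_in I p q \<or> (I \<noteq> {} \<and> p = Max I \<and> q = t)"
proof -
  have "consecutive_in (insert t I) p q \<longleftrightarrow> consecutive_in I p q" if "q \<noteq> t"
    using that below by (fastforce simp: consecutive_in_def)
  moreover have "consecutive_in (insert t I) p t \<longleftrightarrow> p \<in> I \<and> (\<forall>r\<in>I. r \<le> p)"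
    using below by (fastforce simp: consecutive_in_def not_less)
  moreover have "p \<in> I \<and> (\<forall>r\<in>I. r \<le> p) \<longleftrightarrow> I \<noteq> {} \<and> p = Max I"
    using \<open>finite I\<close> by (metis Max_ge Max_in Max_eqI empty_iff)
  moreover have "\<not> consecutive_in I p t"
    using below by (auto simp: consecutive_in_def)
  ultimately show ?thesis by blast
qed

lemma C_subset: "I \<in> C i j \<Longrightarrow> I \<subseteq> {1..j}"
  by (simp add: C_def)

lemma finite_C: "finite (C i j)"
  by (rule finite_subset[of _ "Pow {1..j}"]) (auto simp: C_def)

lemma C_0: "C 0 j = (if even j then {{}} else {})"
proof -
  have "I \<in> C 0 j \<longleftrightarrow> I = {} \<and> even j" for I
    using finite_subset[of I "{1..j}"] by (auto simp: C_def consecutive_in_def)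
  then show ?thesis by auto
qed

lemma C_eq_empty:
  assumes "j < i"
  shows "C i j = {}"
proof -
  have "i \<le> j" if "I \<in> C i j" for I
    using card_mono[OF _ C_subset[OF that]] that by (simp add: C_def)
  with assms show ?thesis by fastforce
qed

lemma insert_Suc_in_C_iff:
  assumes I: "I \<subseteq> {1..j}" and parity: "even (i + j)"
  shows "insert (Suc j) I \<in> C (Suc i) (Suc j) \<longleftrightarrow> I \<in> C i j"
proof -
  have fin: "finite I" and below: "\<And>t. t \<in> I \<Longrightarrow> t < Suc j"
    using I finite_subset by auto
  have card: "card (insert (Suc j) I) = Suc (card I)"
    using fin below by (intro card_insert_disjoint) auto
  have max: "Max (insert (Suc j) I) = Suc j"
    using fin below by (intro Max_eqI) (auto intro: less_imp_le)
  have gap: "odd (Suc j - Max I) \<longleftrightarrow> even (j - Max I)" if "I \<noteq> {}"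
    using below[OF Max_in[OF fin that]] by (simp add: Suc_diff_le)
  have consecutive: "(\<forall>p q. consecutive_in (insert (Suc j) I) p q \<longrightarrow> odd (q - p)) \<longleftrightarrow>
      (\<forall>p q. consecutive_in I p q \<longrightarrow> odd (q - p)) \<and> (I \<noteq> {} \<longrightarrow> even (j - Max I))"
    using fin below gap by (auto simp only: consecutive_in_insert_top)
  have "insert (Suc j) I \<subseteq> {1..Suc j}"
    using I by auto
  with I parity show ?thesis
    unfolding C_def mem_Collect_eq consecutive card max
    by (cases "I = {}") (auto simp: consecutive_in_def[of "{}"])
qed

lemma C_with_top:
  assumes "even (i + j)"
  shows "{I \<in> C (Suc i) (Suc j). Suc j \<in> I} = insert (Suc j) ` C i j"
proof (intro equalityI subsetI)
  fix I assume I: "I \<in> {I \<in> C (Suc i) (Suc j). Suc j \<in> I}"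
  then have reinsert: "insert (Suc j) (I - {Suc j}) = I" and sub: "I - {Suc j} \<subseteq> {1..j}"
    using C_subset[of I "Suc i" "Suc j"] by auto
  from insert_Suc_in_C_iff[OF sub assms] have "I - {Suc j} \<in> C i j"
    unfolding reinsert using I by blast
  with reinsert show "I \<in> insert (Suc j) ` C i j" by blast
next
  fix I assume "I \<in> insert (Suc j) ` C i j"
  then obtain J where "J \<in> C i j" "I = insert (Suc j) J" by blast
  then show "I \<in> {I \<in> C (Suc i) (Suc j). Suc j \<in> I}"
    using insert_Suc_in_C_iff[OF C_subset assms, of J] by blast
qed

lemma C_without_top: "{I \<in> C i (Suc (Suc j)). Suc (Suc j) \<notin> I} = C i j"
proof -
  have in_C_iff: "I \<in> C i (Suc (Suc j)) \<longleftrightarrow> I \<in> C i j" if I: "I \<subseteq> {1..j}" for I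
  proof -
    have "Max I \<le> j" if "I \<noteq> {}"
      using I that finite_subset[OF I] by auto
    moreover have "I \<subseteq> {1..Suc (Suc j)}"
      using I by auto
    ultimately show ?thesis
      using I by (cases "I = {}") (auto simp: C_def Suc_diff_le)
  qed
  have "Suc j \<notin> I" if I: "I \<in> C i (Suc (Suc j))" "Suc (Suc j) \<notin> I" for I
  proof
    assume top: "Suc j \<in> I"
    have "I \<subseteq> {1..Suc j}"
      using C_subset[OF I(1)] I(2) by (force simp: le_Suc_eq)
    then have "Max I = Suc j"
      using top finite_subset[of I] by (intro Max_eqI) auto
    moreover have "I \<noteq> {}"
      using top by blast
    ultimately show False
      using I(1) by (simp add: C_def)
  qed
  then have "I \<subseteq> {1..j}" if "I \<in> C i (Suc (Suc j))" "Suc (Suc j) \<notin> I" for I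
    using C_subset[OF that(1)] that by (force simp: le_Suc_eq)
  moreover have "Suc (Suc j) \<notin> I" if "I \<in> C i j" for I
    using C_subset[OF that] by auto
  ultimately have "I \<in> C i (Suc (Suc j)) \<and> Suc (Suc j) \<notin> I \<longleftrightarrow> I \<in> C i j" for I
    using in_C_iff[of I] C_subset[of I i j] by blast
  then show ?thesis by blast
qed

text \<open>Without the parity condition, the recurrence fails: \<open>C\<^bsub>1,2\<^esub> = {{2}}\<close>, but \<open>C\<^bsub>0,1\<^esub>\<close> is empty
  because of the convention \<open>max {} = 0\<close>.\<close>

lemma gamma_rec:
  assumes "odd (i + j)"
  shows "\<gamma> (Suc i) (Suc (Suc j)) x = x (Suc (Suc j)) * \<gamma> i (Suc j) x + \<gamma> (Suc i) j x"
proof -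
  let ?N = "Suc (Suc j)"
  have "\<gamma> (Suc i) ?N x =
      (\<Sum>I\<in>{I \<in> C (Suc i) ?N. ?N \<in> I}. \<Prod>m\<in>I. x m) +
      (\<Sum>I\<in>{I \<in> C (Suc i) ?N. ?N \<notin> I}. \<Prod>m\<in>I. x m)"
    unfolding \<gamma>_def by (subst sum.union_disjoint[symmetric]) (auto simp: finite_C intro: sum.cong)
  also have "\<dots> = (\<Sum>I\<in>insert ?N ` C i (Suc j). \<Prod>m\<in>I. x m) + \<gamma> (Suc i) j x"
    using assms by (simp add: C_with_top C_without_top \<gamma>_def)
  also have "(\<Sum>I\<in>insert ?N ` C i (Suc j). \<Prod>m\<in>I. x m) = x ?N * \<gamma> i (Suc j) x"
  proof -
    have new: "?N \<notin> I" "finite I" if "I \<in> C i (Suc j)" for I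
      using C_subset[OF that] finite_subset by auto
    then have "inj_on (insert ?N) (C i (Suc j))"
      by (intro inj_onI) (metis insert_ident)
    then show ?thesis
      by (auto simp: \<gamma>_def sum.reindex sum_distrib_left new intro!: sum.cong)
  qed
  finally show ?thesis .
qed

lemma gamma_eq_0: "j < i \<Longrightarrow> \<gamma> i j x = 0"
  by (simp add: \<gamma>_def C_eq_empty)

lemma gamma_0_left: "\<gamma> 0 j x = of_bool (even j)"
  by (simp add: \<gamma>_def C_0)

lemma finite_double_le: "finite {m :: nat. 2 * m \<le> n}"
  by (rule finite_subset[of _ "{..n}"]) auto

lemma G_split_off_leading_term:
  "G n x = \<gamma> n n x - (\<Sum>m | 2 * m + 2 \<le> n. (-1) ^ m * \<gamma> (n - 2 * m - 2) n x)"
proof -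
  let ?M = "{m. 2 * m + 2 \<le> n}"
  have "2 * m \<le> n \<longleftrightarrow> m \<in> insert 0 (Suc ` ?M)" for m
    by (cases m) auto
  then have range: "{m. 2 * m \<le> n} = insert 0 (Suc ` ?M)"
    by blast
  have "finite ?M"
    by (rule finite_subset[OF _ finite_double_le[of n]]) auto
  then have "G n x = \<gamma> n n x + (\<Sum>m\<in>?M. (-1) ^ Suc m * \<gamma> (n - 2 * Suc m) n x)"
    unfolding G_def range by (subst sum.insert) (simp_all add: sum.reindex)
  then show ?thesis
    by (simp add: sum_negf)
qed

lemma G_rec: "G (Suc (Suc n)) x = x (Suc (Suc n)) * G (Suc n) x - G n x"
proof -
  let ?x = "x (Suc (Suc n))"
  let ?lower = "\<lambda>m. (-1) ^ m * \<gamma> (Suc n - 2 * m - 2) (Suc n) x"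
  have gamma: "\<gamma> (n - 2 * m) (Suc (Suc n)) x =
      (if 2 * m + 2 \<le> Suc n then ?x * \<gamma> (Suc n - 2 * m - 2) (Suc n) x else 0) + \<gamma> (n - 2 * m) n x"
    if "2 * m \<le> n" for m
  proof (cases "n - 2 * m")
    case 0
    with that show ?thesis by (simp add: gamma_0_left)
  next
    case (Suc i)
    with that have n: "n = 2 * m + Suc i" by simp
    then have "odd (i + n)" by simp
    from gamma_rec[OF this, of x] Suc n show ?thesis by simp
  qed
  have "(\<Sum>m | 2 * m \<le> n. (-1) ^ m * \<gamma> (n - 2 * m) (Suc (Suc n)) x) =
      (\<Sum>m | 2 * m \<le> n. ?x * (if 2 * m + 2 \<le> Suc n then ?lower m else 0)) + G n x"
    unfolding G_def sum.distrib[symmetric]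
    by (intro sum.cong refl) (simp only: mem_Collect_eq gamma, simp add: distrib_left)
  also have "(\<Sum>m | 2 * m \<le> n. ?x * (if 2 * m + 2 \<le> Suc n then ?lower m else 0)) =
      ?x * (\<Sum>m | 2 * m + 2 \<le> Suc n. ?lower m)"
    unfolding sum_distrib_left[symmetric] sum.inter_filter[OF finite_double_le, symmetric]
    by (intro arg_cong[of _ _ "(*) ?x"] sum.cong) auto
  finally have "G (Suc (Suc n)) x =
      \<gamma> (Suc (Suc n)) (Suc (Suc n)) x - (?x * (\<Sum>m | 2 * m + 2 \<le> Suc n. ?lower m) + G n x)"
    by (simp add: G_split_off_leading_term[of "Suc (Suc n)"])
  also have "\<gamma> (Suc (Suc n)) (Suc (Suc n)) x = ?x * \<gamma> (Suc n) (Suc n) x"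
    using gamma_rec[of "Suc n" n x] by (simp add: gamma_eq_0)
  finally show ?thesis
    by (simp add: G_split_off_leading_term[of "Suc n"] algebra_simps)
qed

lemma F_eq_G: "F n x = G n x"
proof (induction n rule: induct_nat_012)
  case 0
  then show ?case by (simp add: G_def gamma_0_left)
next
  case 1
  have "C 1 1 = {{1}}"
    by (auto simp: C_def consecutive_in_def subset_singleton_iff)
  then have "\<gamma> 1 1 x = x 1"
    by (simp only: \<gamma>_def) simp
  moreover have "{m. 2 * m \<le> Suc 0} = {0}"
    by auto
  ultimately show ?case by (simp add: G_def)
next
  case (ge2 n)
  then show ?case by (simp only: F_rec G_rec)
qed


section \<open>The Smith normal form\<close>

lemma invertible_matE:
  assumes "invertible_mat A" "A \<in> carrier_mat n n"
  obtains B where "B \<in> carrier_mat n n" "A * B = 1\<^sub>m n" "B * A = 1\<^sub>m n"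
proof -
  obtain B where B: "A * B = 1\<^sub>m n" "B * A = 1\<^sub>m (dim_row B)"
    using assms by (auto simp: invertible_mat_def inverts_mat_def)
  have "dim_col B = n" using arg_cong[OF B(1), of dim_col] by simp
  moreover have "dim_row B = n" using arg_cong[OF B(2), of dim_col] assms(2) by simp
  ultimately show ?thesis using that[of B] B by auto
qed

lemma invertible_matI:
  assumes "A \<in> carrier_mat n n" "B \<in> carrier_mat n n" "A * B = 1\<^sub>m n" "B * A = 1\<^sub>m n"
  shows "invertible_mat A"
  using assms unfolding invertible_mat_def inverts_mat_def by (intro conjI exI[of _ B]) auto

definition mod_vec :: "int \<Rightarrow> int vec \<Rightarrow> int vec" where
  "mod_vec m v = map_vec (\<lambda>x. x mod m) v"

lemma mod_vec_carrier [simp]: "mod_vec m v \<in> carrier_vec n \<longleftrightarrow> v \<in> carrier_vec n"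
  by (simp add: mod_vec_def)

lemma mod_vec_index [simp]: "i < dim_vec v \<Longrightarrow> mod_vec m v $ i = v $ i mod m"
  by (simp add: mod_vec_def)

lemma dim_mod_vec [simp]: "dim_vec (mod_vec m v) = dim_vec v"
  by (simp add: mod_vec_def)

lemma mod_vec_idem [simp]: "mod_vec m (mod_vec m v) = mod_vec m v"
  by (intro eq_vecI) auto

lemma mod_vec_mult_mat_vec:
  assumes "A \<in> carrier_mat n k" "v \<in> carrier_vec k"
  shows "mod_vec m (A *\<^sub>v mod_vec m v) = mod_vec m (A *\<^sub>v v)"
proof (intro eq_vecI)
  fix i assume "i < dim_vec (mod_vec m (A *\<^sub>v v))"
  then have i: "i < n" using assms by simp
  have "(\<Sum>j\<in>{0..<k}. A $$ (i, j) * (v $ j mod m)) mod m = (\<Sum>j\<in>{0..<k}. A $$ (i, j) * v $ j) mod m"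
    by (subst (1 2) mod_sum_eq[symmetric]) (simp add: mod_mult_right_eq)
  then show "mod_vec m (A *\<^sub>v mod_vec m v) $ i = mod_vec m (A *\<^sub>v v) $ i"
    using assms i by (simp add: scalar_prod_def)
qed (use assms in auto)

text \<open>The kernel of \<open>A\<close> over \<open>\<int>/m\<int>\<close>, in terms of the representatives \<open>0, \<dots>, m - 1\<close>.\<close>

definition mod_kernel :: "int \<Rightarrow> int mat \<Rightarrow> int vec set" where
  "mod_kernel m A =
     {v \<in> carrier_vec (dim_col A). mod_vec m v = v \<and> mod_vec m (A *\<^sub>v v) = 0\<^sub>v (dim_row A)}"

lemma mod_kernel_subset_mult_left:
  assumes A: "A \<in> carrier_mat n k" and P: "P \<in> carrier_mat l n"
  shows "mod_kernel m A \<subseteq> mod_kernel m (P * A)"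
proof
  fix v assume v: "v \<in> mod_kernel m A"
  then have v_carrier: "v \<in> carrier_vec k" and zero: "mod_vec m (A *\<^sub>v v) = 0\<^sub>v n"
    using A by (auto simp: mod_kernel_def)
  have "mod_vec m (P * A *\<^sub>v v) = mod_vec m (P *\<^sub>v mod_vec m (A *\<^sub>v v))"
    using A P v_carrier
    by (simp add: mod_vec_mult_mat_vec[of _ l n] assoc_mult_mat_vec[of _ l n _ k])
  also have "\<dots> = 0\<^sub>v l"
    unfolding zero using P by (intro eq_vecI) auto
  finally show "v \<in> mod_kernel m (P * A)"
    using v A P by (simp add: mod_kernel_def)
qed

lemma mod_kernel_mult_left:
  assumes A: "A \<in> carrier_mat n k" and P: "P \<in> carrier_mat n n" "invertible_mat P"
  shows "mod_kernel m (P * A) = mod_kernel m A"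
proof
  obtain P' where P': "P' \<in> carrier_mat n n" "P' * P = 1\<^sub>m n"
    using P by (metis invertible_matE)
  have "P' * (P * A) = A"
    using A P(1) P' by (simp flip: assoc_mult_mat[of _ n n _ n _ k])
  then show "mod_kernel m (P * A) \<subseteq> mod_kernel m A"
    using mod_kernel_subset_mult_left[of "P * A" n k P' n m] A P(1) P'(1) by simp
  show "mod_kernel m A \<subseteq> mod_kernel m (P * A)"
    using A P(1) by (rule mod_kernel_subset_mult_left)
qed

lemma mod_vec_mult_in_mod_kernel:
  assumes A: "A \<in> carrier_mat n k" and Q: "Q \<in> carrier_mat k k" and v: "v \<in> mod_kernel m (A * Q)"
  shows "mod_vec m (Q *\<^sub>v v) \<in> mod_kernel m A"
proof -
  have v_carrier: "v \<in> carrier_vec k" using v A Q by (simp add: mod_kernel_def)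
  have "mod_vec m (A *\<^sub>v mod_vec m (Q *\<^sub>v v)) = mod_vec m (A * Q *\<^sub>v v)"
    using A Q v_carrier
    by (simp add: mod_vec_mult_mat_vec[of _ n k] assoc_mult_mat_vec[of _ n k _ k])
  with v A Q v_carrier show ?thesis by (simp add: mod_kernel_def)
qed

lemma mod_vec_mult_mat_vec_inverse:
  assumes Q: "Q \<in> carrier_mat k k" "R \<in> carrier_mat k k" "R * Q = 1\<^sub>m k"
    and v: "v \<in> carrier_vec k" "mod_vec m v = v"
  shows "mod_vec m (R *\<^sub>v mod_vec m (Q *\<^sub>v v)) = v"
proof -
  have "mod_vec m (R *\<^sub>v mod_vec m (Q *\<^sub>v v)) = mod_vec m (R *\<^sub>v (Q *\<^sub>v v))"
    using Q v(1) by (intro mod_vec_mult_mat_vec) auto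
  also have "R *\<^sub>v (Q *\<^sub>v v) = R * Q *\<^sub>v v"
    using Q v(1) by (intro assoc_mult_mat_vec[symmetric])
  finally show ?thesis using Q(3) v by simp
qed

lemma card_mod_kernel_mult_right:
  assumes A: "A \<in> carrier_mat n k" and Q: "Q \<in> carrier_mat k k" "invertible_mat Q"
  shows "card (mod_kernel m (A * Q)) = card (mod_kernel m A)"
proof -
  obtain R where R: "R \<in> carrier_mat k k" "Q * R = 1\<^sub>m k" "R * Q = 1\<^sub>m k"
    using Q by (metis invertible_matE)
  have cancel: "A * Q * R = A"
    using A Q(1) R by (simp add: assoc_mult_mat[of _ n k _ k _ k])
  have "bij_betw (\<lambda>v. mod_vec m (Q *\<^sub>v v)) (mod_kernel m (A * Q)) (mod_kernel m A)"
  proof (rule bij_betw_byWitness[where f' = "\<lambda>v. mod_vec m (R *\<^sub>v v)"])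
    show "(\<lambda>v. mod_vec m (R *\<^sub>v v)) ` mod_kernel m A \<subseteq> mod_kernel m (A * Q)"
      using mod_vec_mult_in_mod_kernel[of "A * Q" n k R _ m] A Q(1) R(1) cancel by auto
  qed (use A Q(1) R mod_vec_mult_in_mod_kernel[OF A Q(1)] in
      \<open>auto simp: mod_kernel_def mod_vec_mult_mat_vec_inverse\<close>)
  then show ?thesis by (rule bij_betw_same_card)
qed

lemma card_annihilated_mod:
  fixes d m :: int
  assumes "m > 0"
  shows "int (card {x \<in> {0..<m}. m dvd d * x}) = gcd d m"
proof -
  define g where "g = gcd d m"
  have g_pos: "g > 0" using assms by (simp add: g_def)
  obtain d' m' where factors: "d = d' * g" "m = m' * g" "coprime d' m'"
    using gcd_coprime_exists[of d m] assms unfolding g_def by auto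
  have m'_pos: "m' > 0" using factors(2) g_pos assms by (simp add: zero_less_mult_iff)
  have annihilated_iff: "m dvd d * x \<longleftrightarrow> m' dvd x" for x
  proof -
    have "m dvd d * x \<longleftrightarrow> g * m' dvd g * (d' * x)" by (simp add: factors mult_ac)
    also have "\<dots> \<longleftrightarrow> m' dvd d' * x" using g_pos by simp
    also have "\<dots> \<longleftrightarrow> m' dvd x"
      using factors(3) by (simp add: coprime_commute coprime_dvd_mult_right_iff)
    finally show ?thesis .
  qed
  have "{x \<in> {0..<m}. m dvd d * x} = (*) m' ` {0..<g}"
  proof (intro equalityI subsetI)
    fix x assume "x \<in> {x \<in> {0..<m}. m dvd d * x}"
    then obtain t where multiple: "x = m' * t" "0 \<le> x" "x < m" by (auto simp: annihilated_iff)
    then have "t \<in> {0..<g}" using m'_pos by (simp add: factors(2) zero_le_mult_iff)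
    with multiple show "x \<in> (*) m' ` {0..<g}" by blast
  next
    fix x assume "x \<in> (*) m' ` {0..<g}"
    then have "m' dvd x" "0 \<le> x" "x < m" using m'_pos by (auto simp: factors(2))
    then show "x \<in> {x \<in> {0..<m}. m dvd d * x}" by (simp add: annihilated_iff)
  qed
  moreover have "inj_on ((*) m') {0..<g}" using m'_pos by (auto simp: inj_on_def)
  ultimately show ?thesis using g_pos by (simp add: card_image g_def)
qed

lemma card_vec_index_in:
  "card {v \<in> carrier_vec n. \<forall>i < n. v $ i \<in> T i} = (\<Prod>i<n. card (T i))"
proof -
  have "bij_betw (\<lambda>v. \<lambda>i\<in>{..<n}. v $ i) {v \<in> carrier_vec n. \<forall>i < n. v $ i \<in> T i} (PiE {..<n} T)"
  proof (rule bij_betw_byWitness[where f' = "vec n"])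
    show "\<forall>f\<in>PiE {..<n} T. (\<lambda>i\<in>{..<n}. vec n f $ i) = f"
      by (simp add: PiE_restrict cong: restrict_cong)
    show "\<forall>v\<in>{v \<in> carrier_vec n. \<forall>i < n. v $ i \<in> T i}. vec n (\<lambda>i\<in>{..<n}. v $ i) = v"
      by (auto intro: eq_vecI)
    show "vec n ` PiE {..<n} T \<subseteq> {v \<in> carrier_vec n. \<forall>i < n. v $ i \<in> T i}"
      by (force simp: PiE_iff)
  qed (auto split: if_splits)
  then have "card {v \<in> carrier_vec n. \<forall>i < n. v $ i \<in> T i} = card (PiE {..<n} T)"
    by (rule bij_betw_same_card)
  then show ?thesis by (simp add: card_PiE)
qed

lemma diagonal_mat_mult_vec_index:
  fixes D :: "'a :: comm_semiring_1 mat"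
  assumes D: "D \<in> carrier_mat n k" "diagonal_mat D" and v: "v \<in> carrier_vec k" and i: "i < n"
  shows "(D *\<^sub>v v) $ i = (if i < k then D $$ (i, i) * v $ i else 0)"
proof -
  have "(D *\<^sub>v v) $ i = (\<Sum>j\<in>{0..<k}. D $$ (i, j) * v $ j)"
    using assms by (simp add: scalar_prod_def)
  also have "\<dots> = (\<Sum>j\<in>{0..<k}. if j = i then D $$ (i, i) * v $ i else 0)"
    using D i by (intro sum.cong) (auto simp: diagonal_mat_def)
  finally show ?thesis by simp
qed

text \<open>A column without a diagonal entry is unconstrained, as if this entry were \<open>0\<close>.\<close>

definition diagonal_entry :: "'a :: zero mat \<Rightarrow> nat \<Rightarrow> 'a" where
  "diagonal_entry D i = (if i < dim_row D \<and> i < dim_col D then D $$ (i, i) else 0)"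

lemma mod_kernel_diagonal_mat:
  assumes D: "D \<in> carrier_mat n k" "diagonal_mat D" and m: "m > 0"
  shows "mod_kernel m D =
    {v \<in> carrier_vec k. \<forall>i < k. v $ i \<in> {x \<in> {0..<m}. m dvd diagonal_entry D i * x}}"
proof -
  have "x mod m = x \<longleftrightarrow> x \<in> {0..<m}" for x
    using m by (metis atLeastLessThan_iff mod_pos_pos_trivial pos_mod_bound pos_mod_sign)
  then have "mod_vec m v = v \<longleftrightarrow> (\<forall>i < k. v $ i \<in> {0..<m})" if "v \<in> carrier_vec k" for v
    using that by (auto simp: vec_eq_iff)
  moreover have "mod_vec m (D *\<^sub>v v) = 0\<^sub>v n \<longleftrightarrow> (\<forall>i < k. m dvd diagonal_entry D i * v $ i)"
    if "v \<in> carrier_vec k" for v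
    using that D
    by (auto simp: vec_eq_iff diagonal_mat_mult_vec_index[OF D that] diagonal_entry_def
        dvd_eq_mod_eq_0 simp del: index_mult_mat_vec)
  ultimately show ?thesis
    using D by (auto simp: mod_kernel_def)
qed

lemma card_mod_kernel_diagonal_mat:
  assumes "D \<in> carrier_mat n k" "diagonal_mat D" "m > 0"
  shows "int (card (mod_kernel m D)) = (\<Prod>i<k. gcd (diagonal_entry D i) m)"
  unfolding mod_kernel_diagonal_mat[OF assms] card_vec_index_in
  by (simp only: of_nat_prod card_annihilated_mod[OF \<open>m > 0\<close>])

text \<open>From the index \<open>i\<close> on, all factors of the left product are \<open>m\<close>, so no factor of the right
  product can be smaller.\<close>

lemma dvd_if_prod_gcd_eq:
  fixes d e :: "nat \<Rightarrow> int"
  assumes prod: "(\<Prod>j<n. gcd (d j) m) = (\<Prod>j<n. gcd (e j) m)" and m: "m > 0"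
    and prefix: "\<And>j. j < i \<Longrightarrow> \<bar>d j\<bar> = \<bar>e j\<bar>"
    and dvd: "\<And>j. i \<le> j \<Longrightarrow> j < n \<Longrightarrow> m dvd d j" and i: "i < n"
  shows "m dvd e i"
proof -
  have split: "(\<Prod>j<n. f j) = (\<Prod>j<i. f j) * (\<Prod>j=i..<n. f j)" for f :: "nat \<Rightarrow> int"
    using i by (simp add: prod.atLeastLessThan_concat flip: atLeast0LessThan)
  have "(\<Prod>j<i. gcd (d j) m) = (\<Prod>j<i. gcd (e j) m)"
    using prefix by (intro prod.cong refl) (metis gcd_abs1_int lessThan_iff)
  moreover have "(\<Prod>j<i. gcd (e j) m) \<noteq> 0"
    using m by simp
  moreover have "(\<Prod>j=i..<n. gcd (d j) m) = (\<Prod>j=i..<n. m)"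
    using m dvd by (intro prod.cong refl) (simp add: gcd_proj2_if_dvd_int)
  ultimately have "(\<Prod>j=i..<n. m) = (\<Prod>j=i..<n. gcd (e j) m)"
    using prod unfolding split by (simp only: mult_cancel_left simp_thms)
  also have "\<dots> = gcd (e i) m * (\<Prod>j=Suc i..<n. gcd (e j) m)"
    using i by (rule prod.atLeast_Suc_lessThan)
  also have "\<dots> \<le> gcd (e i) m * (\<Prod>j=Suc i..<n. m)"
    using m by (intro mult_left_mono prod_mono) (auto intro: gcd_le2_int)
  finally have "m * (\<Prod>j=Suc i..<n. m) \<le> gcd (e i) m * (\<Prod>j=Suc i..<n. m)"
    by (simp only: prod.atLeast_Suc_lessThan[OF i])
  then have "m \<le> gcd (e i) m"
    using m by (simp add: mult_le_cancel_right)
  then show ?thesis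
    using m gcd_le2_int[of m "e i"] by (metis gcd_dvd1 order_antisym)
qed

lemma dvd_if_positive_divisors_dvd:
  fixes a b :: int
  assumes "\<And>m. m > 0 \<Longrightarrow> m dvd a \<Longrightarrow> m dvd b"
  shows "a dvd b"
proof (cases "a = 0")
  case True
  then have "\<bar>b\<bar> + 1 dvd b" using assms by simp
  then have "b = 0" using dvd_imp_le_int[of b "\<bar>b\<bar> + 1"] by force
  then show ?thesis by simp
next
  case False
  then show ?thesis using assms[of "\<bar>a\<bar>"] by simp
qed

lemma divisor_chain_unique:
  fixes d e :: "nat \<Rightarrow> int"
  assumes prod: "\<And>m. m > 0 \<Longrightarrow> (\<Prod>j<n. gcd (d j) m) = (\<Prod>j<n. gcd (e j) m)"
    and chain: "\<And>i j. i \<le> j \<Longrightarrow> j < n \<Longrightarrow> d i dvd d j" "\<And>i j. i \<le> j \<Longrightarrow> j < n \<Longrightarrow> e i dvd e j"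
    and "i < n"
  shows "\<bar>d i\<bar> = \<bar>e i\<bar>"
  using \<open>i < n\<close>
proof (induction i rule: less_induct)
  case (less i)
  then have prefix: "\<bar>d j\<bar> = \<bar>e j\<bar>" if "j < i" for j
    using that by simp
  have "m dvd e i" if m: "m > 0" "m dvd d i" for m
  proof (rule dvd_if_prod_gcd_eq[OF prod[OF m(1)] m(1) prefix _ less.prems])
    show "m dvd d j" if "i \<le> j" "j < n" for j
      using m(2) chain(1)[OF that] by (rule dvd_trans)
  qed
  moreover have "m dvd d i" if m: "m > 0" "m dvd e i" for m
  proof (rule dvd_if_prod_gcd_eq[OF prod[OF m(1), symmetric] m(1) prefix[symmetric] _ less.prems])
    show "m dvd e j" if "i \<le> j" "j < n" for j
      using m(2) chain(2)[OF that] by (rule dvd_trans)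
  qed
  ultimately show ?case
    by (metis dvd_if_positive_divisors_dvd zdvd_antisym_abs)
qed

lemma smith_normal_form_of_dims:
  assumes "smith_normal_form_of A D"
  shows "dim_row D = dim_row A" "dim_col D = dim_col A"
  using assms by (auto simp: smith_normal_form_of_def)

lemma smith_normal_form_of_card_mod_kernel:
  assumes "smith_normal_form_of A D"
  shows "card (mod_kernel m D) = card (mod_kernel m A)"
proof -
  obtain P Q where P: "P \<in> carrier_mat (dim_row A) (dim_row A)" "invertible_mat P"
    and Q: "Q \<in> carrier_mat (dim_col A) (dim_col A)" "invertible_mat Q" and D: "D = P * A * Q"
    using assms by (auto simp: smith_normal_form_of_def)
  have A: "A \<in> carrier_mat (dim_row A) (dim_col A)" by simp
  have "card (mod_kernel m D) = card (mod_kernel m (P * A))"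
    unfolding D using P(1) Q by (intro card_mod_kernel_mult_right) auto
  then show ?thesis
    using mod_kernel_mult_left[OF A P] by simp
qed

lemma smith_normal_form_of_diagonal_entry_dvd:
  assumes D: "smith_normal_form_of A D" and "i \<le> j"
  shows "diagonal_entry D i dvd diagonal_entry D j"
  using \<open>i \<le> j\<close>
proof (induction j rule: dec_induct)
  case (step j)
  have "diagonal_entry D j dvd diagonal_entry D (Suc j)"
    using D by (auto simp: smith_normal_form_of_def diagonal_entry_def)
  with step.IH show ?case by (rule dvd_trans)
qed simp

lemma smith_normal_form_unique:
  assumes D: "smith_normal_form_of A D" and E: "smith_normal_form_of A E"
    and i: "i < dim_row A" "i < dim_col A"
  shows "\<bar>D $$ (i, i)\<bar> = \<bar>E $$ (i, i)\<bar>"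
proof -
  have count: "(\<Prod>j<dim_col A. gcd (diagonal_entry B j) m) = int (card (mod_kernel m A))"
    if B: "smith_normal_form_of A B" and m: "m > 0" for B m
  proof -
    have "B \<in> carrier_mat (dim_row A) (dim_col A)"
      using smith_normal_form_of_dims[OF B] by (rule carrier_matI)
    moreover have "diagonal_mat B"
      using B by (simp add: smith_normal_form_of_def)
    ultimately have "int (card (mod_kernel m B)) = (\<Prod>j<dim_col A. gcd (diagonal_entry B j) m)"
      using m by (rule card_mod_kernel_diagonal_mat)
    then show ?thesis
      by (simp add: smith_normal_form_of_card_mod_kernel[OF B])
  qed
  have "\<bar>diagonal_entry D i\<bar> = \<bar>diagonal_entry E i\<bar>"
  proof (rule divisor_chain_unique[OF _ _ _ i(2)])
    fix m :: int assume "m > 0"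
    then show "(\<Prod>j<dim_col A. gcd (diagonal_entry D j) m) =
        (\<Prod>j<dim_col A. gcd (diagonal_entry E j) m)"
      by (simp only: count[OF D] count[OF E])
  qed (rule smith_normal_form_of_diagonal_entry_dvd[OF D]
      smith_normal_form_of_diagonal_entry_dvd[OF E], assumption)+
  with i show ?thesis
    using smith_normal_form_of_dims[OF D] smith_normal_form_of_dims[OF E]
    by (simp add: diagonal_entry_def)
qed

lemma invertible_mat_if_det_dvd_1:
  fixes A :: "'a :: comm_ring_1 mat"
  assumes A: "A \<in> carrier_mat n n" and unit: "det A dvd 1"
  shows "invertible_mat A"
proof -
  obtain u where u: "det A * u = 1" using unit by (metis dvdE)
  have "u \<cdot>\<^sub>m (det A \<cdot>\<^sub>m 1\<^sub>m n) = 1\<^sub>m n"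
    using u by (intro eq_matI) (auto simp: mult.commute)
  then have "A * (u \<cdot>\<^sub>m adj_mat A) = 1\<^sub>m n" "u \<cdot>\<^sub>m adj_mat A * A = 1\<^sub>m n"
    using A adj_mat[OF A]
    by (simp_all add: mult_smult_distrib[of _ n n _ n] mult_smult_assoc_mat[of _ n n _ n])
  moreover have "u \<cdot>\<^sub>m adj_mat A \<in> carrier_mat n n"
    using adj_mat(1)[OF A] by simp
  ultimately show ?thesis using A by (intro invertible_matI)
qed

lemma invertible_mat_if_permuted_triangular:
  fixes A :: "'a :: comm_ring_1 mat"
  assumes A: "A \<in> carrier_mat n n" and p: "p permutes {0..<n}"
    and triangular: "(\<forall>i j. i < j \<longrightarrow> j < n \<longrightarrow> A $$ (p i, j) = 0) \<or>
      (\<forall>i j. j < i \<longrightarrow> i < n \<longrightarrow> A $$ (p i, j) = 0)"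
    and diagonal: "\<And>i. i < n \<Longrightarrow> A $$ (p i, i) dvd 1"
  shows "invertible_mat A"
proof -
  let ?B = "mat n n (\<lambda>(i, j). A $$ (p i, j))"
  have "det ?B = prod_list (diag_mat ?B)"
    using triangular
    by (elim disjE; intro det_lower_triangular[of n] det_upper_triangular[of _ n]) auto
  also have "\<dots> = (\<Prod>i = 0..<n. A $$ (p i, i))"
    by (simp add: prod_list_diag_prod)
  also have "\<dots> dvd (\<Prod>i = 0..<n. 1)" using diagonal by (intro prod_dvd_prod) auto
  finally have "det ?B dvd 1" by simp
  then have "det A dvd 1"
    unfolding det_permute_rows[OF A p] by (rule dvd_mult_right)
  with A show ?thesis by (rule invertible_mat_if_det_dvd_1)
qed

lemma smith_normal_form_of_mat_diagI:
  assumes A: "A \<in> carrier_mat n n" and S: "S \<in> carrier_mat n n" "invertible_mat S"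
    and T: "T \<in> carrier_mat n n" "invertible_mat T"
    and columns: "\<And>j. j < n \<Longrightarrow> A *\<^sub>v col S j = d j \<cdot>\<^sub>v col T j"
    and chain: "\<And>i. Suc i < n \<Longrightarrow> d i dvd d (Suc i)"
  shows "smith_normal_form_of A (mat_diag n d)"
proof -
  have basis_change: "A * S = T * mat_diag n d"
  proof (rule mat_col_eqI)
    fix j assume "j < dim_col (T * mat_diag n d)"
    then have j: "j < n" by (simp add: mat_diag_def)
    have "col (T * mat_diag n d) j = d j \<cdot>\<^sub>v col T j"
      using T(1) j by (intro eq_vecI) (auto simp: mat_diag_mult_right[OF T(1)] mult.commute)
    then show "col (A * S) j = col (T * mat_diag n d) j"
      using columns[OF j] A S(1) j by (simp add: col_mult2[of A n n S n])
  qed (use A S(1) T(1) in \<open>auto simp: mat_diag_def\<close>)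
  obtain T' where T': "T' \<in> carrier_mat n n" "T * T' = 1\<^sub>m n" "T' * T = 1\<^sub>m n"
    using T by (metis invertible_matE)
  have "T' * A * S = T' * (T * mat_diag n d)"
    using T'(1) A S(1) by (simp add: assoc_mult_mat[of _ n n _ n _ n] basis_change)
  also have "\<dots> = mat_diag n d"
    using T' T(1)
    by (simp add: left_mult_one_mat[OF mat_diag_dim] flip: assoc_mult_mat[of _ n n _ n _ n])
  finally have factorization: "mat_diag n d = T' * A * S" ..
  have "invertible_mat T'"
    using T'(1) T(1) T'(3,2) by (rule invertible_matI)
  with A S T'(1) factorization
  have "\<exists>P Q. P \<in> carrier_mat (dim_row A) (dim_row A) \<and> invertible_mat P \<and>
      Q \<in> carrier_mat (dim_col A) (dim_col A) \<and> invertible_mat Q \<and> mat_diag n d = P * A * Q"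
    by (intro exI[of _ T'] exI[of _ S]) simp
  then show ?thesis
    by (simp add: smith_normal_form_of_def) (simp add: mat_diag_def diagonal_mat_def chain)
qed


section \<open>Sandpile groups and Laplacians\<close>

lemma sum_group_cong:
  assumes "\<And>i. i \<in> I \<Longrightarrow> H i = K i"
  shows "sum_group I H = sum_group I K"
proof -
  have "product_group I H = product_group I K"
    using assms by (auto simp: product_group_def cong: restrict_cong PiE_cong)
  then show ?thesis
    using assms by (simp add: sum_group_def cong: PiE_cong conj_cong)
qed

lemma sum_group_iso_factor:
  assumes group: "\<And>i. i \<in> I \<Longrightarrow> group (H i)" and k: "k \<in> I"
    and trivial: "\<And>i. i \<in> I \<Longrightarrow> i \<noteq> k \<Longrightarrow> carrier (H i) = {\<one>\<^bsub>H i\<^esub>}"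
  shows "sum_group I H \<cong> H k"
proof (intro is_isoI isoI)
  let ?extend = "\<lambda>g. \<lambda>i\<in>I. if i = k then g else \<one>\<^bsub>H i\<^esub>"
  show "(\<lambda>x. x k) \<in> hom (sum_group I H) (H k)"
    using k by (auto simp: hom_def carrier_sum_group group)
  show "bij_betw (\<lambda>x. x k) (carrier (sum_group I H)) (carrier (H k))"
  proof (rule bij_betw_byWitness[where f' = ?extend])
    show "\<forall>x\<in>carrier (sum_group I H). ?extend (x k) = x"
    proof (intro ballI ext)
      fix x i assume "x \<in> carrier (sum_group I H)"
      then have "x \<in> PiE I (\<lambda>i. carrier (H i))"
        by (simp add: carrier_sum_group group)
      then show "?extend (x k) i = x i"
        using trivial[of i] PiE_mem[of x I "\<lambda>i. carrier (H i)" i] PiE_arb[of x I _ i] by auto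
    qed
    show "?extend ` carrier (H k) \<subseteq> carrier (sum_group I H)"
    proof
      fix x assume "x \<in> ?extend ` carrier (H k)"
      then obtain g where g: "g \<in> carrier (H k)" "x = ?extend g" by blast
      have "finite {i \<in> I. x i \<noteq> \<one>\<^bsub>H i\<^esub>}"
        by (rule finite_subset[of _ "{k}"]) (auto simp: g)
      then show "x \<in> carrier (sum_group I H)"
        using g group by (auto simp: carrier_sum_group intro!: monoid.one_closed group.is_monoid)
    qed
  qed (use k in \<open>auto simp: carrier_sum_group group\<close>)
qed

lemma sandpile_group_eq:
  assumes D: "smith_normal_form_of (laplacian X) D"
  shows "sandpile_group X = sum_group {i. i < dim_row D \<and> D $$ (i, i) \<noteq> 0}
    (\<lambda>i. integer_mod_group (nat \<bar>D $$ (i, i)\<bar>))"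
proof -
  define E where "E = (SOME D. smith_normal_form_of (laplacian X) D)"
  have E: "smith_normal_form_of (laplacian X) E"
    unfolding E_def using D by (rule someI)
  have dims: "dim_row E = dim_row D" "dim_row (laplacian X) = dim_row D"
    "dim_col (laplacian X) = dim_row D"
    using smith_normal_form_of_dims[OF D] smith_normal_form_of_dims[OF E]
    by (simp_all add: laplacian_def Let_def)
  then have abs: "\<bar>E $$ (i, i)\<bar> = \<bar>D $$ (i, i)\<bar>" if "i < dim_row D" for i
    using smith_normal_form_unique[OF E D] that by simp
  have index: "{i. i < dim_row E \<and> E $$ (i, i) \<noteq> 0} = {i. i < dim_row D \<and> D $$ (i, i) \<noteq> 0}"
    using abs by (fastforce simp: dims)
  show ?thesis
    unfolding sandpile_group_def Let_def E_def[symmetric] index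
    by (rule sum_group_cong) (simp add: abs)
qed

lemma sandpile_group_iso_integer_mod_group:
  assumes D: "smith_normal_form_of (laplacian X) D" and k: "k < dim_row D" "D $$ (k, k) \<noteq> 0"
    and units: "\<And>i. i < dim_row D \<Longrightarrow> i \<noteq> k \<Longrightarrow> D $$ (i, i) \<in> {-1, 0, 1}"
  shows "sandpile_group X \<cong> integer_mod_group (nat \<bar>D $$ (k, k)\<bar>)"
  unfolding sandpile_group_eq[OF D]
proof (rule sum_group_iso_factor)
  fix i assume "i \<in> {i. i < dim_row D \<and> D $$ (i, i) \<noteq> 0}" "i \<noteq> k"
  then have "\<bar>D $$ (i, i)\<bar> = 1" using units[of i] by auto
  then show "carrier (integer_mod_group (nat \<bar>D $$ (i, i)\<bar>)) =
      {\<one>\<^bsub>integer_mod_group (nat \<bar>D $$ (i, i)\<bar>)\<^esub>}"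
    by (auto simp: carrier_integer_mod_group)
qed (use k in auto)

lemma laplacian_carrier: "laplacian X \<in> carrier_mat (card (verts X)) (card (verts X))"
  by (simp add: laplacian_def Let_def)

lemma sum_mset_minus_sum:
  "(\<Sum>e\<in>#M. c - (\<Sum>u\<in>U. g e u)) = of_nat (size M) * c - (\<Sum>u\<in>U. \<Sum>e\<in>#M. g e u :: 'a :: comm_ring_1)"
  by (induction M) (simp_all add: sum.distrib algebra_simps)

lemma sum_differences_at_vertex:
  fixes f :: "'v \<Rightarrow> 'a :: comm_ring_1"
  assumes X: "finite_multigraph X" and v: "v \<in> verts X"
  shows "(\<Sum>e\<in>#{#e \<in># edges X. v \<in> e#}. \<Sum>u\<in>e. f v - f u) =
    of_nat (Defs.degree X v) * f v - (\<Sum>u\<in>verts X - {v}. of_nat (count (edges X) {v, u}) * f u)"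
proof -
  let ?M = "{#e \<in># edges X. v \<in> e#}" and ?U = "verts X - {v}"
  have fin: "finite ?U" using X by (simp add: finite_multigraph_def)
  have "(\<Sum>u\<in>e. f v - f u) = f v - (\<Sum>u\<in>?U. if e = {v, u} then f u else 0)" if "e \<in># ?M" for e
  proof -
    have "card e = 2" "v \<in> e" "e \<subseteq> verts X"
      using that X by (auto simp: finite_multigraph_def)
    then obtain w where w: "e = {v, w}" "w \<in> ?U"
      by (auto simp: card_2_iff)
    then have "(\<Sum>u\<in>?U. if e = {v, u} then f u else 0) = (\<Sum>u\<in>?U. if u = w then f w else 0)"
      by (intro sum.cong refl) (auto simp: doubleton_eq_iff)
    moreover have "v \<noteq> w" using w by blast
    ultimately show ?thesis using w fin by simp
  qed
  then have "(\<Sum>e\<in>#?M. \<Sum>u\<in>e. f v - f u) =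
      (\<Sum>e\<in>#?M. f v - (\<Sum>u\<in>?U. if e = {v, u} then f u else 0))"
    by (intro arg_cong[of _ _ sum_mset] image_mset_cong)
  also have "\<dots> = of_nat (size ?M) * f v - (\<Sum>u\<in>?U. of_nat (count ?M {v, u}) * f u)"
    unfolding sum_mset_minus_sum by (simp add: sum_mset_delta mult.commute)
  finally show ?thesis by (simp add: Defs.degree_def)
qed

definition vertex_vec :: "'v :: linorder multigraph \<Rightarrow> ('v \<Rightarrow> int) \<Rightarrow> int vec" where
  "vertex_vec X f = vec (card (verts X)) (\<lambda>i. f (sorted_list_of_set (verts X) ! i))"

lemma laplacian_mult_vertex_vec:
  fixes X :: "'v :: linorder multigraph"
  assumes X: "finite_multigraph X" and i: "i < card (verts X)"
    and v: "v = sorted_list_of_set (verts X) ! i"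
  shows "(laplacian X *\<^sub>v vertex_vec X f) $ i =
    (\<Sum>e\<in>#{#e \<in># edges X. v \<in> e#}. \<Sum>u\<in>e. f v - f u)"
proof -
  let ?vs = "sorted_list_of_set (verts X)"
  let ?entry = "\<lambda>u. if u = v then int (Defs.degree X v) else - int (count (edges X) {v, u})"
  have fin: "finite (verts X)" using X by (simp add: finite_multigraph_def)
  have v_in: "v \<in> verts X" using i nth_mem[of i ?vs] fin by (simp add: v)
  have "(laplacian X *\<^sub>v vertex_vec X f) $ i =
      (\<Sum>j<card (verts X). ?entry (?vs ! j) * f (?vs ! j))"
    using i v by (auto simp: laplacian_def vertex_vec_def Let_def scalar_prod_def lessThan_atLeast0
        nth_eq_iff_index_eq intro!: sum.cong)
  also have "\<dots> = (\<Sum>u\<in>verts X. ?entry u * f u)"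
    using fin by (intro sum.reindex_bij_betw bij_betw_nth) auto
  also have "\<dots> = int (Defs.degree X v) * f v + (\<Sum>u\<in>verts X - {v}. ?entry u * f u)"
    by (subst sum.remove[OF fin v_in]) simp
  also have "(\<Sum>u\<in>verts X - {v}. ?entry u * f u) =
      - (\<Sum>u\<in>verts X - {v}. int (count (edges X) {v, u}) * f u)"
    unfolding sum_negf[symmetric] by (intro sum.cong) auto
  finally show ?thesis using sum_differences_at_vertex[OF X v_in, of f] by simp
qed


section \<open>Chains of cycles\<close>

lemma sum_mset_filter_image_mset_set:
  "finite S \<Longrightarrow>
    (\<Sum>e\<in>#{#e \<in># image_mset g (mset_set S). P e#}. h e) = (\<Sum>x | x \<in> S \<and> P (g x). h (g x))"
  by (simp add: filter_mset_image_mset sum_unfold_sum_mset image_mset.compositionality comp_def)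

lemma chain_pos_0: "chain_pos a 0 = 1"
  by (simp add: chain_pos_def)

lemma chain_pos_Suc: "chain_pos a (Suc j) = chain_pos a j + (a (Suc j) - 2)"
  by (simp add: chain_pos_def)

locale cycle_chain =
  fixes n :: nat and a :: "nat \<Rightarrow> int"
  assumes length_ge_2: "\<And>m. 1 \<le> m \<Longrightarrow> m \<le> n \<Longrightarrow> 2 \<le> a m"
begin

text \<open>The path is \<open>u\<^sub>1, \<dots>, u\<^bsub>r+1\<^esub>\<close>; using \<open>r = k - 1\<close> avoids truncated subtraction.\<close>

definition r :: nat where "r = nat (chain_pos a n - 1)"

abbreviation N :: nat where "N \<equiv> Suc (Suc r)"

abbreviation X :: "int multigraph" where "X \<equiv> chain n a"

definition spokes_at :: "int \<Rightarrow> nat" where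
  "spokes_at v = card {j \<in> {0..n}. chain_pos a j = v}"

lemma chain_pos_le: "i \<le> j \<Longrightarrow> j \<le> n \<Longrightarrow> chain_pos a i \<le> chain_pos a j"
  using length_ge_2 by (rule chain_pos_mono)

lemma chain_pos_ge_1: "j \<le> n \<Longrightarrow> 1 \<le> chain_pos a j"
  using chain_pos_le[of 0 j] by (simp add: chain_pos_0)

lemma chain_pos_n: "chain_pos a n = int (Suc r)"
  using chain_pos_ge_1[of n] by (simp add: r_def)

lemma chain_pos_le_last: "j \<le> n \<Longrightarrow> chain_pos a j \<le> int (Suc r)"
  using chain_pos_le[of j n] by (simp add: chain_pos_n)

lemma verts_chain: "verts X = {0..int (Suc r)}"
  by (auto simp: chain_def chain_pos_n)

lemma card_verts_chain: "card (verts X) = N"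
  by (simp add: verts_chain)

lemma sorted_verts_chain_nth:
  assumes "i < N"
  shows "sorted_list_of_set (verts X) ! i = int i"
proof -
  have "sorted_list_of_set {0..int (Suc r)} = [0..int (Suc r)]"
    using sorted_list_of_set.idem_if_sorted_distinct[of "[0..int (Suc r)]"] by simp
  with assms show ?thesis
    by (simp add: verts_chain nth_upto)
qed

lemma laplacian_chain_carrier: "laplacian X \<in> carrier_mat N N"
  using laplacian_carrier[of X] by (simp only: card_verts_chain)

lemma dim_vertex_vec_chain: "dim_vec (vertex_vec X f) = N"
  by (simp add: vertex_vec_def card_verts_chain)

lemma vertex_vec_chain_index: "i < N \<Longrightarrow> vertex_vec X f $ i = f (int i)"
  by (simp add: vertex_vec_def card_verts_chain sorted_verts_chain_nth)

lemma laplacian_chain_mult_vertex_vec: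
  assumes i: "i < N"
  shows "(laplacian X *\<^sub>v vertex_vec X f) $ i =
    (\<Sum>l | l \<in> {1..<int (Suc r)} \<and> int i \<in> {l, l + 1}. \<Sum>u\<in>{l, l + 1}. f (int i) - f u) +
    (\<Sum>j | j \<in> {0..n} \<and> int i \<in> {0, chain_pos a j}. \<Sum>u\<in>{0, chain_pos a j}. f (int i) - f u)"
proof -
  have "int i = sorted_list_of_set (verts X) ! i"
    using i by (simp add: sorted_verts_chain_nth)
  then have "(laplacian X *\<^sub>v vertex_vec X f) $ i =
      (\<Sum>e\<in>#{#e \<in># edges X. int i \<in> e#}. \<Sum>u\<in>e. f (int i) - f u)"
    using i length_ge_2
    by (intro laplacian_mult_vertex_vec finite_multigraph_chain) (simp_all only: card_verts_chain)
  then show ?thesis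
    by (simp only: chain_def multigraph.select_convs chain_pos_n filter_union_mset image_mset_union
        sum_mset.union sum_mset_filter_image_mset_set finite_atLeastLessThan_int finite_atLeastAtMost)
qed

lemma laplacian_chain_center:
  "(laplacian X *\<^sub>v vertex_vec X f) $ 0 = (\<Sum>j = 0..n. f 0 - f (chain_pos a j))"
proof -
  have "(\<Sum>l | l \<in> {1..<int (Suc r)} \<and> int 0 \<in> {l, l + 1}. \<Sum>u\<in>{l, l + 1}. f (int 0) - f u) = 0"
    by (rule sum.neutral) auto
  moreover have
    "(\<Sum>j | j \<in> {0..n} \<and> int 0 \<in> {0, chain_pos a j}. \<Sum>u\<in>{0, chain_pos a j}. f (int 0) - f u) =
      (\<Sum>j = 0..n. f 0 - f (chain_pos a j))"
  proof (intro sum.cong)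
    fix j assume "j \<in> {0..n}"
    then have "chain_pos a j \<noteq> 0" using chain_pos_ge_1[of j] by auto
    then show "(\<Sum>u\<in>{0, chain_pos a j}. f (int 0) - f u) = f 0 - f (chain_pos a j)" by simp
  qed auto
  ultimately show ?thesis
    unfolding laplacian_chain_mult_vertex_vec[OF zero_less_Suc] by simp
qed

lemma laplacian_chain_path:
  assumes i: "1 \<le> i" "i \<le> Suc r" and v: "v = int i"
  shows "(laplacian X *\<^sub>v vertex_vec X f) $ i = int (spokes_at v) * (f v - f 0) +
    (if i = 1 then 0 else f v - f (v - 1)) + (if i = Suc r then 0 else f v - f (v + 1))"
proof -
  have "{l. l \<in> {1..<int (Suc r)} \<and> v \<in> {l, l + 1}} =
      (if i = 1 then {} else {v - 1}) \<union> (if i = Suc r then {} else {v})"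
    using i v by auto
  then have "(\<Sum>l | l \<in> {1..<int (Suc r)} \<and> v \<in> {l, l + 1}. \<Sum>u\<in>{l, l + 1}. f v - f u) =
      (if i = 1 then 0 else f v - f (v - 1)) + (if i = Suc r then 0 else f v - f (v + 1))"
    by simp
  moreover have "(\<Sum>j | j \<in> {0..n} \<and> v \<in> {0, chain_pos a j}. \<Sum>u\<in>{0, chain_pos a j}. f v - f u) =
      (\<Sum>j | j \<in> {0..n} \<and> chain_pos a j = v. f v - f 0)"
    using i v by (intro sum.cong) auto
  moreover have "\<dots> = int (spokes_at v) * (f v - f 0)"
    by (simp add: spokes_at_def)
  ultimately show ?thesis
    using i v by (simp only: laplacian_chain_mult_vertex_vec le_imp_less_Suc)
qed

text \<open>Harmonicity at \<open>u\<^sub>1, \<dots>, u\<^bsub>k-1\<^esub>\<close> means that the slope grows at the end of spoke \<open>l\<close> by the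
  value that the potential takes there.\<close>

definition spoke_value :: "nat \<Rightarrow> int" where
  "spoke_value l = F l a - (if l = 0 then 0 else F (l - 1) a)"

definition slope :: "int \<Rightarrow> int" where
  "slope v = (\<Sum>l = 0..n. if chain_pos a l \<le> v then spoke_value l else 0)"

definition potential :: "int \<Rightarrow> int" where
  "potential v =
    (if v = 0 then 0 else 1 + (\<Sum>l = 0..n. max 0 (v - chain_pos a l) * spoke_value l))"

lemma sum_spoke_value: "(\<Sum>l = 0..j. spoke_value l) = F j a"
  by (induction j) (simp_all add: spoke_value_def del: F.simps(3))

lemma spoke_value_Suc: "spoke_value (Suc j) = spoke_value j + (a (Suc j) - 2) * F j a"
  by (cases j) (simp_all add: spoke_value_def F_rec algebra_simps del: F.simps(3))

lemma spoke_value_eq: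
  "spoke_value j = 1 + (\<Sum>l = 0..j. (chain_pos a j - chain_pos a l) * spoke_value l)"
proof (induction j)
  case 0
  then show ?case by (simp add: spoke_value_def)
next
  case (Suc j)
  have "(\<Sum>l = 0..Suc j. (chain_pos a (Suc j) - chain_pos a l) * spoke_value l) =
      (\<Sum>l = 0..j. (chain_pos a j - chain_pos a l) * spoke_value l +
        (a (Suc j) - 2) * spoke_value l)"
    by (simp add: chain_pos_Suc algebra_simps)
  also have "\<dots> = (\<Sum>l = 0..j. (chain_pos a j - chain_pos a l) * spoke_value l) +
      (a (Suc j) - 2) * F j a"
    by (simp only: sum.distrib sum_distrib_left[symmetric] sum_spoke_value)
  finally show ?case using Suc by (simp add: spoke_value_Suc)
qed

lemma potential_0: "potential 0 = 0"
  by (simp add: potential_def)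

lemma potential_chain_pos:
  assumes "j \<le> n"
  shows "potential (chain_pos a j) = spoke_value j"
proof -
  have "(\<Sum>l = 0..n. max 0 (chain_pos a j - chain_pos a l) * spoke_value l) =
      (\<Sum>l = 0..j. max 0 (chain_pos a j - chain_pos a l) * spoke_value l)"
    using assms chain_pos_le[of j] by (intro sum.mono_neutral_right) auto
  also have "\<dots> = (\<Sum>l = 0..j. (chain_pos a j - chain_pos a l) * spoke_value l)"
    using assms chain_pos_le[of _ j] by (intro sum.cong refl) (simp add: max_def)
  finally show ?thesis
    using spoke_value_eq[of j] chain_pos_ge_1[OF assms] by (simp add: potential_def)
qed

lemma potential_1: "potential 1 = 1"
  using potential_chain_pos[of 0] by (simp add: chain_pos_0 spoke_value_def)

lemma potential_add_1:
  assumes "1 \<le> v"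
  shows "potential (v + 1) = potential v + slope v"
proof -
  have "max 0 (v + 1 - chain_pos a l) * spoke_value l =
      max 0 (v - chain_pos a l) * spoke_value l +
      (if chain_pos a l \<le> v then spoke_value l else 0)" for l
    by (simp add: max_def algebra_simps)
  with assms show ?thesis
    by (simp add: potential_def slope_def sum.distrib)
qed

lemma slope_0: "slope 0 = 0"
  unfolding slope_def using chain_pos_ge_1 by (intro sum.neutral) fastforce

lemma slope_last: "slope (int (Suc r)) = F n a"
  unfolding slope_def sum_spoke_value[symmetric] using chain_pos_le_last by (intro sum.cong) auto

lemma slope_diff: "slope v - slope (v - 1) = int (spokes_at v) * potential v"
proof -
  have "int (spokes_at v) * potential v = (\<Sum>j | j \<in> {0..n} \<and> chain_pos a j = v. potential v)"
    by (simp add: spokes_at_def)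
  also have "\<dots> = (\<Sum>j | j \<in> {0..n} \<and> chain_pos a j = v. spoke_value j)"
    by (intro sum.cong refl) (auto simp: potential_chain_pos)
  also have "\<dots> = (\<Sum>j = 0..n. if chain_pos a j = v then spoke_value j else 0)"
    by (rule sum.inter_filter) simp
  also have "\<dots> = slope v - slope (v - 1)"
    unfolding slope_def sum_subtractf[symmetric] by (intro sum.cong) auto
  finally show ?thesis ..
qed

lemma laplacian_chain_potential:
  "laplacian X *\<^sub>v vertex_vec X potential = F n a \<cdot>\<^sub>v (unit_vec N (Suc r) - unit_vec N 0)"
proof (rule eq_vecI)
  fix i assume "i < dim_vec (F n a \<cdot>\<^sub>v (unit_vec N (Suc r) - unit_vec N 0))"
  then have i: "i < N" by simp
  have "(laplacian X *\<^sub>v vertex_vec X potential) $ i =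
      F n a * (if i = Suc r then 1 else if i = 0 then -1 else 0)"
  proof (cases "i = 0")
    case True
    have "(\<Sum>j = 0..n. potential 0 - potential (chain_pos a j)) = - F n a"
      unfolding sum_spoke_value[symmetric] sum_negf[symmetric]
      by (intro sum.cong refl) (simp add: potential_chain_pos potential_0)
    with True show ?thesis by (simp add: laplacian_chain_center)
  next
    case False
    have "(if i = 1 then 0 else potential (int i) - potential (int i - 1)) = slope (int i - 1)"
      using False potential_add_1[of "int i - 1"] slope_0 by auto
    moreover have "(if i = Suc r then 0 else potential (int i) - potential (int i + 1)) =
        (if i = Suc r then F n a else 0) - slope (int i)"
      using False potential_add_1[of "int i"] slope_last by auto
    moreover have "int (spokes_at (int i)) * (potential (int i) - potential 0) =
        slope (int i) - slope (int i - 1)"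
      by (simp add: slope_diff potential_0)
    ultimately show ?thesis
      using False i laplacian_chain_path[of i "int i" potential] by simp
  qed
  with i show "(laplacian X *\<^sub>v vertex_vec X potential) $ i =
      (F n a \<cdot>\<^sub>v (unit_vec N (Suc r) - unit_vec N 0)) $ i"
    by simp
qed (use laplacian_chain_carrier in auto)

lemma laplacian_chain_const: "laplacian X *\<^sub>v vertex_vec X (\<lambda>_. c) = 0\<^sub>v N"
proof (rule eq_vecI)
  fix i assume "i < dim_vec (0\<^sub>v N :: int vec)"
  then show "(laplacian X *\<^sub>v vertex_vec X (\<lambda>_. c)) $ i = 0\<^sub>v N $ i"
    by (simp add: laplacian_chain_mult_vertex_vec)
qed (use laplacian_chain_carrier in auto)

definition source :: "nat \<Rightarrow> int vec" where
  "source j = vertex_vec X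
     (if j < r then (\<lambda>v. of_bool (v = int j + 2)) else if j = r then potential else (\<lambda>_. 1))"

definition target :: "nat \<Rightarrow> int vec" where
  "target j = (if j < r then laplacian X *\<^sub>v source j
     else if j = r then unit_vec N (Suc r) - unit_vec N 0
     else unit_vec N 0)"

definition elementary_divisor :: "nat \<Rightarrow> int" where
  "elementary_divisor i = (if i < r then 1 else if i = r then F n a else 0)"

lemma laplacian_chain_source:
  "j < N \<Longrightarrow> laplacian X *\<^sub>v source j = elementary_divisor j \<cdot>\<^sub>v target j"
  by (auto simp: source_def target_def elementary_divisor_def laplacian_chain_potential
      laplacian_chain_const less_Suc_eq)

definition source_basis :: "int mat" where
  "source_basis = mat N N (\<lambda>(i, j). source j $ i)"

definition target_basis :: "int mat" where
  "target_basis = mat N N (\<lambda>(i, j). target j $ i)"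

lemma source_basis_carrier: "source_basis \<in> carrier_mat N N"
  by (simp add: source_basis_def)

lemma target_basis_carrier: "target_basis \<in> carrier_mat N N"
  by (simp add: target_basis_def)

lemma invertible_source_basis: "invertible_mat source_basis"
proof (rule invertible_mat_if_permuted_triangular)
  let ?p = "\<lambda>i. if i < r then Suc (Suc i) else if i = r then 1 else if i = Suc r then 0 else i"
  show "?p permutes {0..<N}"
    by (rule inj_imp_permutes) (auto simp: inj_on_def split: if_splits)
  show "(\<forall>i j. i < j \<longrightarrow> j < N \<longrightarrow> source_basis $$ (?p i, j) = 0) \<or>
      (\<forall>i j. j < i \<longrightarrow> i < N \<longrightarrow> source_basis $$ (?p i, j) = 0)"
    by (rule disjI2) (auto simp: source_basis_def source_def vertex_vec_chain_index potential_0)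
  show "source_basis $$ (?p i, i) dvd 1" if "i < N" for i
    using that by (auto simp: source_basis_def source_def vertex_vec_chain_index potential_1)
qed (rule source_basis_carrier)

lemma target_Suc_index:
  assumes "i \<le> j" "j < r"
  shows "target j $ Suc i = (if i = j then -1 else 0)"
  using assms laplacian_chain_path[of "Suc i" _ "\<lambda>v. of_bool (v = int j + 2)"]
  by (auto simp: target_def source_def)

lemma invertible_target_basis: "invertible_mat target_basis"
proof (rule invertible_mat_if_permuted_triangular)
  let ?p = "\<lambda>i. if i < Suc r then Suc i else if i = Suc r then 0 else i"
  show "?p permutes {0..<N}"
    by (rule inj_imp_permutes) (auto simp: inj_on_def split: if_splits)
  show "(\<forall>i j. i < j \<longrightarrow> j < N \<longrightarrow> target_basis $$ (?p i, j) = 0) \<or>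
      (\<forall>i j. j < i \<longrightarrow> i < N \<longrightarrow> target_basis $$ (?p i, j) = 0)"
  proof (intro disjI1 allI impI)
    fix i j assume ij: "i < j" "j < N"
    then have "target j $ Suc i = 0"
      using target_Suc_index[of i j] by (cases "j < r") (auto simp: target_def)
    with ij show "target_basis $$ (?p i, j) = 0" by (simp add: target_basis_def)
  qed
  show "target_basis $$ (?p i, i) dvd 1" if "i < N" for i
    using that target_Suc_index[of i i] by (auto simp: target_basis_def target_def)
qed (rule target_basis_carrier)

lemma smith_normal_form_laplacian_chain:
  "smith_normal_form_of (laplacian X) (mat_diag N elementary_divisor)"
proof (rule smith_normal_form_of_mat_diagI)
  fix j assume j: "j < N"
  have "col source_basis j = source j" "col target_basis j = target j"
    using j laplacian_chain_carrier
    by (auto simp: source_basis_def target_basis_def source_def target_def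
        dim_vertex_vec_chain intro!: eq_vecI)
  then show "laplacian X *\<^sub>v col source_basis j = elementary_divisor j \<cdot>\<^sub>v col target_basis j"
    using laplacian_chain_source[OF j] by simp
  show "elementary_divisor i dvd elementary_divisor (Suc i)" if "Suc i < N" for i
    using that by (simp add: elementary_divisor_def)
qed (rule laplacian_chain_carrier source_basis_carrier invertible_source_basis
    target_basis_carrier invertible_target_basis)+

lemma sandpile_group_chain: "sandpile_group X \<cong> integer_mod_group (nat (F n a))"
proof -
  have "F n a > 0" using length_ge_2 by (rule F_pos)
  then show ?thesis
    using sandpile_group_iso_integer_mod_group[OF smith_normal_form_laplacian_chain, of r]
    by (simp add: mat_diag_def elementary_divisor_def)
qed

end

theorem theorem4:
  fixes n :: nat and a :: "nat \<Rightarrow> int"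
  assumes "n \<ge> 1"
    and "\<And>m. 1 \<le> m \<Longrightarrow> m \<le> n \<Longrightarrow> a m \<ge> 2"
  shows "F n a > 0 \<and> F n a = G n a \<and>
         sandpile_group (chain n a) \<cong> integer_mod_group (nat (F n a)) \<and>
         integer_mod_group (nat (F n a)) \<cong> integer_mod_group (nat (G n a))"
proof -
  interpret cycle_chain n a by unfold_locales (fact assms(2))
  have "F n a > 0"
    using assms(2) by (rule F_pos)
  moreover have "F n a = G n a"
    by (rule F_eq_G)
  ultimately show ?thesis
    using sandpile_group_chain iso_refl by simp
qed

end
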